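(* Let $\mathfrak{Z}\subseteq\bigcup_{n\in\mathbb{N}}\mathcal{P}(\mathbb{Z}^n)$ and $\mathfrak{D}\subseteq\bigcup_{n\in\mathbb{N}}\mathcal{P}(\mathbb{D}^n)$, where $\mathbb{D}=[0,1[$. If $\mathfrak{Z}$ and $\mathfrak{D}$ are stable, then the class $\mathfrak{Z}\uplus\mathfrak{D}$ is stable.
   Context: $\mathcal{P}(X)$ denotes the power set of $X$, and $\mathbb{D}=[0,1[=\{x\in\mathbb{R}\mid 0\le x<1\}$. For $A,B\subseteq\mathbb{R}^n$, $A+B=\{a+b\mid a\in A,\ b\in B\}$ (so the sum is empty if $A$ or $B$ is empty). For $n\in\mathbb{N}$ put $\mathfrak{Z}_n=\mathfrak{Z}\cap\mathcal{P}(\mathbb{Z}^n)$ and $\mathfrak{D}_n=\mathfrak{D}\cap\mathcal{P}(\mathbb{D}^n)$. The class $\mathfrak{Z}_n\uplus\mathfrak{D}_n$ is the class of all sets $R\subseteq\mathbb{R}^n$ of the form $R=\bigcup_{i=1}^p(Z_i+D_i)$ with $p\ge 1$ and $(Z_i,D_i)\in\mathfrak{Z}_n\times\mathfrak{D}_n$ for every $i$. Then $\mathfrak{Z}\uplus\mathfrak{D}=\bigcup_{n\in\mathbb{N}}\mathfrak{Z}_n\uplus\mathfrak{D}_n$. (The symbol $\uplus$ does not denote disjoint union.) A class $\mathfrak{R}\subseteq\bigcup_{n\in\mathbb{N}}\mathcal{P}(\mathbb{R}^n)$ is called stable if it is closed under: (1) boolean operations: union, intersection and difference of two members that are subsets of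 the same $\mathbb{R}^n$; (2) cartesian product (the product of $R\subseteq\mathbb{R}^n$ and $R'\subseteq\mathbb{R}^m$ being viewed as a subset of $\mathbb{R}^{n+m}$); (3) quantification: for $R\subseteq\mathbb{R}^n$ and $1\le i\le n$, $\exists_i R=\{(r_1,\dots,r_{i-1},r_{i+1},\dots,r_n)\mid \exists r_i\ (r_1,\dots,r_n)\in R\}$; (4) reordering: for $R\subseteq\mathbb{R}^n$ and a permutation $\pi$ of $\{1,\dots,n\}$, $\pi R=\{(r_{\pi(1)},\dots,r_{\pi(n)})\mid (r_1,\dots,r_n)\in R\}$. The classes $\mathfrak{Z}$ and $\mathfrak{D}$ are regarded as classes of subsets of the $\mathbb{R}^n$, so the same definition applies to them. *)

theory Defs
  imports Complex_Main "HOL-Library.NList" "HOL-Combinatorics.Permutations"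
begin

text \<open>
  A point of \<open>A\<^sup>n\<close> is a list of length \<open>n\<close> with entries in \<open>A\<close>, that is, an element of
  \<^term>\<open>nlists n A\<close>; in particular \<open>A\<^sup>0\<close> consists of the empty list only. The dimension varies
  over all natural numbers, including \<open>0\<close>. The empty set is a subset of every \<open>\<real>\<^sup>n\<close>,
  and a class contains it either in all dimensions or in none. Coordinates are numbered from \<open>0\<close>.
\<close>

text \<open>The sum is only applied to sets of lists of one common length, so that \<^const>\<open>map2\<close>
  does not truncate.\<close>

definition set_sum :: "real list set \<Rightarrow> real list set \<Rightarrow> real list set"
  where "set_sum A B = {map2 (+) a b | a b. a \<in> A \<and> b \<in> B}"

definition set_product :: "real list set \<Rightarrow> real list set \<Rightarrow> real list set"
  where "set_product R R' = {r @ r' | r r'. r \<in> R \<and> r' \<in> R'}"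

definition project_out :: "nat \<Rightarrow> real list set \<Rightarrow> real list set"
  where "project_out i R = {u @ v | u v. length u = i \<and> (\<exists>x. u @ x # v \<in> R)}"

text \<open>In the last clause, \<^term>\<open>permute_list \<pi> r\<close> is the list
  \<open>(r\<^bsub>\<pi>(0)\<^esub>, \<dots>, r\<^bsub>\<pi>(n-1)\<^esub>)\<close>.\<close>

definition stable_class :: "real list set set \<Rightarrow> bool"
  where "stable_class \<RR> \<longleftrightarrow>
    \<RR> \<subseteq> (\<Union>n. Pow (nlists n UNIV)) \<and>
    (\<forall>n. \<forall>R \<in> \<RR> \<inter> Pow (nlists n UNIV). \<forall>R' \<in> \<RR> \<inter> Pow (nlists n UNIV).
      R \<union> R' \<in> \<RR> \<and> R \<inter> R' \<in> \<RR> \<and> R - R' \<in> \<RR>) \<and>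
    (\<forall>n m. \<forall>R \<in> \<RR> \<inter> Pow (nlists n UNIV). \<forall>R' \<in> \<RR> \<inter> Pow (nlists m UNIV).
      set_product R R' \<in> \<RR>) \<and>
    (\<forall>n. \<forall>R \<in> \<RR> \<inter> Pow (nlists n UNIV). \<forall>i<n. project_out i R \<in> \<RR>) \<and>
    (\<forall>n. \<forall>R \<in> \<RR> \<inter> Pow (nlists n UNIV). \<forall>\<pi>. \<pi> permutes {..<n} \<longrightarrow> permute_list \<pi> ` R \<in> \<RR>)"

definition mixed_level ::
    "real list set set \<Rightarrow> real list set set \<Rightarrow> nat \<Rightarrow> real list set set"
  where "mixed_level \<ZZ> \<DD> n =
    {\<Union>i\<in>{1..p}. set_sum (Z i) (D i) | (p::nat) Z D. p \<ge> 1 \<and>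
      (\<forall>i\<in>{1..p}. Z i \<in> \<ZZ> \<inter> Pow (nlists n \<int>) \<and> D i \<in> \<DD> \<inter> Pow (nlists n {0..<1}))}"

definition mixed_class ::
    "real list set set \<Rightarrow> real list set set \<Rightarrow> real list set set"  (infixl "\<uplus>" 65)
  where "\<ZZ> \<uplus> \<DD> = (\<Union>n. mixed_level \<ZZ> \<DD> n)"

end

theory Submission
  imports Defs
begin

text \<open>
  Every real is uniquely the sum of an integer and an element of \<open>[0, 1)\<close>, so \<open>Z + D\<close> consists of the
  points whose integer part lies in \<open>Z\<close> and whose fractional part lies in \<open>D\<close>. Hence all the operations
  act on a sum \<open>Z + D\<close> componentwise, except for the difference, where
  \<open>(Z + D) - (Z' + D') = ((Z - Z') + D) \<union> (Z + (D - D'))\<close>; they extend to finite unions of such sums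
  by distributivity.
\<close>

declare nlistsE_length [simp del] nlistsE_set [simp del]

lemma set_sumI: "a \<in> A \<Longrightarrow> b \<in> B \<Longrightarrow> map2 (+) a b \<in> set_sum A B"
  unfolding set_sum_def by blast

lemma set_productI: "r \<in> R \<Longrightarrow> r' \<in> R' \<Longrightarrow> r @ r' \<in> set_product R R'"
  unfolding set_product_def by blast

lemma project_outI: "u @ x # v \<in> R \<Longrightarrow> length u = i \<Longrightarrow> u @ v \<in> project_out i R"
  unfolding project_out_def by blast

section \<open>Stable classes\<close>

lemma Pow_nlists_UNIV: "R \<in> \<RR> \<inter> Pow (nlists n A) \<Longrightarrow> R \<in> \<RR> \<inter> Pow (nlists n UNIV)"
  using nlists_mono[OF subset_UNIV, of n A] by blast

lemma length_subset_nlists: "R \<subseteq> nlists n A \<Longrightarrow> r \<in> R \<Longrightarrow> length r = n"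
  by (blast dest: nlistsE_length)

text \<open>\<open>stable_class\<close> speaks of the ambient \<open>nlists n UNIV\<close> only,
  whereas the components of a mixed set must stay integral or fractional. In the closure lemmas
  below, an arbitrary \<open>A\<close> is therefore carried along.\<close>

lemma stable_class_boolean:
  assumes "stable_class \<RR>" "R \<in> \<RR> \<inter> Pow (nlists n A)" "R' \<in> \<RR> \<inter> Pow (nlists n A)"
  shows "R \<union> R' \<in> \<RR> \<inter> Pow (nlists n A)" "R \<inter> R' \<in> \<RR> \<inter> Pow (nlists n A)"
    "R - R' \<in> \<RR> \<inter> Pow (nlists n A)"
proof -
  have R: "R \<in> \<RR> \<inter> Pow (nlists n UNIV)" "R' \<in> \<RR> \<inter> Pow (nlists n UNIV)"
    using assms(2,3)[THEN Pow_nlists_UNIV] .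
  have "R \<union> R' \<in> \<RR> \<and> R \<inter> R' \<in> \<RR> \<and> R - R' \<in> \<RR>"
    using assms(1)[unfolded stable_class_def, THEN conjunct2, THEN conjunct1,
        THEN spec, THEN bspec, OF R(1), THEN bspec, OF R(2)] .
  then show "R \<union> R' \<in> \<RR> \<inter> Pow (nlists n A)" "R \<inter> R' \<in> \<RR> \<inter> Pow (nlists n A)"
    "R - R' \<in> \<RR> \<inter> Pow (nlists n A)"
    using assms(2,3) by auto
qed

text \<open>The empty set arises as \<open>R - R\<close>. It carries no dimension, so
  \<open>m\<close> and \<open>B\<close> are unrelated to \<open>n\<close> and \<open>A\<close>; this
  later moves an empty set between levels.\<close>

lemma stable_class_empty:
  assumes "stable_class \<RR>" "R \<in> \<RR> \<inter> Pow (nlists n A)"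
  shows "{} \<in> \<RR> \<inter> Pow (nlists m B)"
  using stable_class_boolean(3)[OF assms assms(2)] by simp

lemma stable_class_product:
  assumes "stable_class \<RR>" "R \<in> \<RR> \<inter> Pow (nlists n A)" "R' \<in> \<RR> \<inter> Pow (nlists m A)"
  shows "set_product R R' \<in> \<RR> \<inter> Pow (nlists (n + m) A)"
proof -
  have R: "R \<in> \<RR> \<inter> Pow (nlists n UNIV)" "R' \<in> \<RR> \<inter> Pow (nlists m UNIV)"
    using assms(2,3)[THEN Pow_nlists_UNIV] .
  have "set_product R R' \<in> \<RR>"
    using assms(1)[unfolded stable_class_def, THEN conjunct2, THEN conjunct2, THEN conjunct1,
        THEN spec, THEN spec, THEN bspec, OF R(1), THEN bspec, OF R(2)] .
  moreover have "set_product R R' \<subseteq> nlists (n + m) A"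
    using assms(2,3) unfolding set_product_def nlists_def by fastforce
  ultimately show ?thesis by simp
qed

lemma stable_class_project_out:
  assumes "stable_class \<RR>" "R \<in> \<RR> \<inter> Pow (nlists n A)" "i < n"
  shows "project_out i R \<in> \<RR> \<inter> Pow (nlists (n - 1) A)"
proof -
  have R: "R \<in> \<RR> \<inter> Pow (nlists n UNIV)"
    using assms(2) by (rule Pow_nlists_UNIV)
  have "project_out i R \<in> \<RR>"
    using assms(1)[unfolded stable_class_def, THEN conjunct2, THEN conjunct2,
        THEN conjunct2, THEN conjunct1, THEN spec, THEN bspec, OF R, THEN spec, THEN mp, OF assms(3)] .
  \<comment> \<open>Removing the entry \<open>x\<close> shortens a list by one; \<open>n - 1\<close>
    is a true subtraction because \<open>i < n\<close>.\<close>
  moreover have "project_out i R \<subseteq> nlists (n - 1) A"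
    using assms(2) unfolding project_out_def nlists_def by fastforce
  ultimately show ?thesis by simp
qed

lemma stable_class_permute:
  assumes "stable_class \<RR>" "R \<in> \<RR> \<inter> Pow (nlists n A)" "\<pi> permutes {..<n}"
  shows "permute_list \<pi> ` R \<in> \<RR> \<inter> Pow (nlists n A)"
proof -
  have R: "R \<in> \<RR> \<inter> Pow (nlists n UNIV)"
    using assms(2) by (rule Pow_nlists_UNIV)
  have "permute_list \<pi> ` R \<in> \<RR>"
    using assms(1)[unfolded stable_class_def, THEN conjunct2, THEN conjunct2,
        THEN conjunct2, THEN conjunct2, THEN spec, THEN bspec, OF R, THEN spec, THEN mp, OF assms(3)] .
  moreover have "permute_list \<pi> r \<in> nlists n A" if "r \<in> R" for r
  proof -
    have "r \<in> nlists n A" using that assms(2) by blast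
    then show ?thesis using assms(3) by (simp add: nlists_def)
  qed
  ultimately show ?thesis by auto
qed

section \<open>Sums of an integral set and a fractional set\<close>

text \<open>Uniqueness of integer and fractional parts turns membership in a sum into two
  independent conditions on one point, so boolean operations on sums become propositional
  logic.\<close>

lemma set_sum_eq:
  assumes "Z \<subseteq> nlists n \<int>" "D \<subseteq> nlists n {0..<1}"
  shows "set_sum Z D = {r. map (\<lambda>x. of_int \<lfloor>x\<rfloor>) r \<in> Z \<and> map frac r \<in> D}"
proof (intro equalityI subsetI)
  fix r assume "r \<in> set_sum Z D"
  then obtain z d where r: "r = map2 (+) z d" "z \<in> Z" "d \<in> D"
    by (auto simp: set_sum_def)
  have len: "length z = n" "length d = n" and ran: "set z \<subseteq> \<int>" "set d \<subseteq> {0..<1}"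
    using r(2,3) assms by (auto simp: nlists_def)
  \<comment> \<open>The integer entry survives the floor because the added entry lies in
    \<open>{0..<1}\<close>; subtracting it then leaves the other entry as
    \<open>frac\<close>.\<close>
  have floor: "of_int \<lfloor>z ! i + d ! i\<rfloor> = z ! i" if "i < n" for i
  proof -
    have "z ! i \<in> \<int>" "d ! i \<in> {0..<1}"
      using that len ran nth_mem[of i z] nth_mem[of i d] by (simp_all only: subset_iff)
    then obtain k where "z ! i = of_int k" "0 \<le> d ! i" "d ! i < 1"
      by (auto elim: Ints_cases)
    then have "\<lfloor>z ! i + d ! i\<rfloor> = k" by (simp add: floor_eq_iff)
    then show ?thesis using \<open>z ! i = of_int k\<close> by simp
  qed
  have "map (\<lambda>x. of_int \<lfloor>x\<rfloor>) r = z"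
    using len floor by (intro nth_equalityI) (auto simp: r)
  moreover have "map frac r = d"
    using len floor by (intro nth_equalityI) (auto simp: r frac_def)
  ultimately show "r \<in> {r. map (\<lambda>x. of_int \<lfloor>x\<rfloor>) r \<in> Z \<and> map frac r \<in> D}"
    using r by simp
next
  fix r assume "r \<in> {r. map (\<lambda>x. of_int \<lfloor>x\<rfloor>) r \<in> Z \<and> map frac r \<in> D}"
  \<comment> \<open>Conversely, every real list splits entrywise, which supplies the two
    summands.\<close>
  moreover have "r = map2 (+) (map (\<lambda>x. of_int \<lfloor>x\<rfloor>) r) (map frac r)"
    by (intro nth_equalityI) (auto simp: frac_def)
  ultimately show "r \<in> set_sum Z D"
    by (metis (no_types, lifting) mem_Collect_eq set_sumI)
qed

section \<open>Boolean operations on sums\<close>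

lemma set_sum_Int:
  assumes "Z \<subseteq> nlists n \<int>" "D \<subseteq> nlists n {0..<1}" "Z' \<subseteq> nlists n \<int>" "D' \<subseteq> nlists n {0..<1}"
  shows "set_sum Z D \<inter> set_sum Z' D' = set_sum (Z \<inter> Z') (D \<inter> D')"
proof -
  have "Z \<inter> Z' \<subseteq> nlists n \<int>" "D \<inter> D' \<subseteq> nlists n {0..<1}" using assms by auto
  note eqs = set_sum_eq[OF assms(1,2)] set_sum_eq[OF assms(3,4)] set_sum_eq[OF this]
  show ?thesis unfolding eqs by auto
qed

text \<open>A point misses the second sum iff its integer part misses \<open>Z'\<close> or its
  fractional part misses \<open>D'\<close>. The two alternatives give the two pieces on the right,
  which may overlap.\<close>

lemma set_sum_Diff:
  assumes "Z \<subseteq> nlists n \<int>" "D \<subseteq> nlists n {0..<1}" "Z' \<subseteq> nlists n \<int>" "D' \<subseteq> nlists n {0..<1}"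
  shows "set_sum Z D - set_sum Z' D' = set_sum (Z - Z') D \<union> set_sum Z (D - D')"
proof -
  have sub: "Z - Z' \<subseteq> nlists n \<int>" "D - D' \<subseteq> nlists n {0..<1}" using assms by auto
  note eqs = set_sum_eq[OF assms(1,2)] set_sum_eq[OF assms(3,4)]
    set_sum_eq[OF sub(1) assms(2)] set_sum_eq[OF assms(1) sub(2)]
  show ?thesis unfolding eqs by auto
qed

section \<open>Product, projection and reordering of sums\<close>

lemma set_sum_product:
  assumes "Z \<subseteq> nlists n A" "D \<subseteq> nlists n B"
  shows "set_product (set_sum Z D) (set_sum Z' D') = set_sum (set_product Z Z') (set_product D D')"
proof -
  \<comment> \<open>\<open>map2\<close> splits at the append because the first blocks
    \<open>z\<close> and \<open>d\<close> share the length \<open>n\<close>.\<close>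
  have app: "map2 (+) (z @ z') (d @ d') = map2 (+) z d @ map2 (+) z' d'"
    if "z \<in> Z" "d \<in> D" for z z' d d'
    using that assms by (simp add: length_subset_nlists[of _ n])
  show ?thesis
  proof (intro equalityI subsetI)
    fix r assume "r \<in> set_product (set_sum Z D) (set_sum Z' D')"
    then obtain z z' d d' where "r = map2 (+) z d @ map2 (+) z' d'"
      "z \<in> Z" "z' \<in> Z'" "d \<in> D" "d' \<in> D'"
      unfolding set_product_def set_sum_def by blast
    then show "r \<in> set_sum (set_product Z Z') (set_product D D')"
      by (simp add: app[symmetric] set_sumI set_productI)
  next
    fix r assume "r \<in> set_sum (set_product Z Z') (set_product D D')"
    then obtain z z' d d' where "r = map2 (+) (z @ z') (d @ d')"
      "z \<in> Z" "z' \<in> Z'" "d \<in> D" "d' \<in> D'"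
      unfolding set_product_def set_sum_def by blast
    then show "r \<in> set_product (set_sum Z D) (set_sum Z' D')"
      by (simp add: app set_sumI set_productI del: zip_append)
  qed
qed

text \<open>The quantifier distributes over the sum: a removed entry of the sum splits into an entry
  of each summand, and conversely witnesses chosen independently for \<open>Z\<close> and
  \<open>D\<close> can be added.\<close>

lemma set_sum_project_out:
  assumes "Z \<subseteq> nlists n A" "D \<subseteq> nlists n B"
  shows "project_out i (set_sum Z D) = set_sum (project_out i Z) (project_out i D)"
proof (intro equalityI subsetI)
  fix r assume "r \<in> project_out i (set_sum Z D)"
  then obtain u v x z d where r: "r = u @ v" "length u = i" and
    eq: "u @ x # v = map2 (+) z d" and zd: "z \<in> Z" "d \<in> D"
    unfolding project_out_def set_sum_def by blast
  have len: "length z = length d" using zd assms by (simp add: length_subset_nlists[of _ n])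
  have i: "i < length z" using arg_cong[OF eq, of length] r len by simp
  \<comment> \<open>The witnesses for the two projections are the entries \<open>z ! i\<close> and
    \<open>d ! i\<close>.\<close>
  have "take i z @ drop (Suc i) z \<in> project_out i Z"
    using zd i id_take_nth_drop[OF i] by (intro project_outI[of _ "z ! i"]) auto
  moreover have "take i d @ drop (Suc i) d \<in> project_out i D"
    using zd i len id_take_nth_drop[of i d] by (intro project_outI[of _ "d ! i"]) auto
  moreover have "u = map2 (+) (take i z) (take i d)"
    using arg_cong[OF eq, of "take i"] r by (simp add: take_map take_zip)
  moreover have "v = map2 (+) (drop (Suc i) z) (drop (Suc i) d)"
    using arg_cong[OF eq, of "drop (Suc i)"] r by (simp add: drop_map drop_zip)
  ultimately show "r \<in> set_sum (project_out i Z) (project_out i D)"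
    using r(1) len set_sumI[of "take i z @ drop (Suc i) z" _ "take i d @ drop (Suc i) d"] by simp
next
  fix r assume "r \<in> set_sum (project_out i Z) (project_out i D)"
  then obtain u v x u' v' x' where r: "r = map2 (+) (u @ v) (u' @ v')"
    "length u = i" "length u' = i" and zd: "u @ x # v \<in> Z" "u' @ x' # v' \<in> D"
    unfolding project_out_def set_sum_def by blast
  \<comment> \<open>The witness is \<open>x + x'\<close>; it sits at position \<open>i\<close> on
    both sides since \<open>u\<close> and \<open>u'\<close> both have length
    \<open>i\<close>.\<close>
  have "map2 (+) u u' @ (x + x') # map2 (+) v v' = map2 (+) (u @ x # v) (u' @ x' # v')"
    using r by simp
  then have "map2 (+) u u' @ (x + x') # map2 (+) v v' \<in> set_sum Z D"
    using zd by (simp only: set_sumI)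
  moreover have "r = map2 (+) u u' @ map2 (+) v v'" "length (map2 (+) u u') = i"
    using r by auto
  ultimately show "r \<in> project_out i (set_sum Z D)"
    unfolding project_out_def by blast
qed

lemma set_sum_permute:
  assumes "Z \<subseteq> nlists n A" "D \<subseteq> nlists n B" "\<pi> permutes {..<n}"
  shows "permute_list \<pi> ` set_sum Z D = set_sum (permute_list \<pi> ` Z) (permute_list \<pi> ` D)"
proof -
  \<comment> \<open>Entrywise addition commutes with moving positions, as both lists have the length
    on which \<open>\<pi>\<close> acts.\<close>
  have eq: "permute_list \<pi> (map2 (+) z d) = map2 (+) (permute_list \<pi> z) (permute_list \<pi> d)"
    if "z \<in> Z" "d \<in> D" for z d
  proof -
    have "length z = n" "length d = n"
      using that assms length_subset_nlists by blast+
    then show ?thesis using assms(3) by (simp add: permute_list_map permute_list_zip)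
  qed
  show ?thesis
  proof (intro equalityI subsetI)
    fix r assume "r \<in> permute_list \<pi> ` set_sum Z D"
    then obtain z d where "r = permute_list \<pi> (map2 (+) z d)" "z \<in> Z" "d \<in> D"
      unfolding set_sum_def by blast
    then show "r \<in> set_sum (permute_list \<pi> ` Z) (permute_list \<pi> ` D)"
      using eq unfolding set_sum_def by blast
  next
    fix r assume "r \<in> set_sum (permute_list \<pi> ` Z) (permute_list \<pi> ` D)"
    then obtain z d where r: "r = map2 (+) (permute_list \<pi> z) (permute_list \<pi> d)"
      and zd: "z \<in> Z" "d \<in> D"
      unfolding set_sum_def by blast
    have "map2 (+) z d \<in> set_sum Z D" using zd by (rule set_sumI)
    then show "r \<in> permute_list \<pi> ` set_sum Z D"
      using r eq[OF zd] by (auto intro!: rev_image_eqI)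
  qed
qed

section \<open>The mixed class\<close>

lemma set_sum_in_mixed_level:
  assumes "Z \<in> \<ZZ> \<inter> Pow (nlists n \<int>)" "D \<in> \<DD> \<inter> Pow (nlists n {0..<1})"
  shows "set_sum Z D \<in> mixed_level \<ZZ> \<DD> n"
  unfolding mixed_level_def
  by (rule CollectI, rule exI[of _ 1], rule exI[of _ "\<lambda>_. Z"], rule exI[of _ "\<lambda>_. D"])
    (use assms in auto)

lemma mixed_level_Un:
  assumes "X \<in> mixed_level \<ZZ> \<DD> n" "Y \<in> mixed_level \<ZZ> \<DD> n"
  shows "X \<union> Y \<in> mixed_level \<ZZ> \<DD> n"
proof -
  obtain p :: nat and Z D where X: "X = (\<Union>i\<in>{1..p}. set_sum (Z i) (D i))" "p \<ge> 1"
    "\<forall>i\<in>{1..p}. Z i \<in> \<ZZ> \<inter> Pow (nlists n \<int>) \<and> D i \<in> \<DD> \<inter> Pow (nlists n {0..<1})"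
    using assms(1) unfolding mixed_level_def by blast
  obtain q :: nat and Z' D' where Y: "Y = (\<Union>i\<in>{1..q}. set_sum (Z' i) (D' i))" "q \<ge> 1"
    "\<forall>i\<in>{1..q}. Z' i \<in> \<ZZ> \<inter> Pow (nlists n \<int>) \<and> D' i \<in> \<DD> \<inter> Pow (nlists n {0..<1})"
    using assms(2) unfolding mixed_level_def by blast
  \<comment> \<open>The two families are concatenated: indices up to \<open>p\<close> run through
    the first, and for larger \<open>i\<close> the number \<open>i - p\<close> runs through the
    second from \<open>1\<close> on.\<close>
  define Z'' where "Z'' = (\<lambda>i. if i \<le> p then Z i else Z' (i - p))"
  define D'' where "D'' = (\<lambda>i. if i \<le> p then D i else D' (i - p))"
  have split: "{1..p + q} = {1..p} \<union> (\<lambda>i. i + p) ` {1..q}"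
    by (auto simp: image_iff Bex_def)
  have "X \<union> Y = (\<Union>i\<in>{1..p + q}. set_sum (Z'' i) (D'' i))"
  proof -
    have "(\<Union>i\<in>{1..p + q}. set_sum (Z'' i) (D'' i)) =
        (\<Union>i\<in>{1..p}. set_sum (Z'' i) (D'' i)) \<union> (\<Union>i\<in>{1..q}. set_sum (Z'' (i + p)) (D'' (i + p)))"
      unfolding split by blast
    also have "\<dots> = X \<union> Y"
      unfolding X(1) Y(1)
      by (intro arg_cong2[of _ _ _ _ "(\<union>)"] SUP_cong) (auto simp: Z''_def D''_def)
    finally show ?thesis by (rule sym)
  qed
  moreover have "\<forall>i\<in>{1..p + q}. Z'' i \<in> \<ZZ> \<inter> Pow (nlists n \<int>) \<and> D'' i \<in> \<DD> \<inter> Pow (nlists n {0..<1})"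
  proof
    fix i assume "i \<in> {1..p + q}"
    then have "i \<in> {1..p} \<or> \<not> i \<le> p \<and> i - p \<in> {1..q}" by auto
    then show "Z'' i \<in> \<ZZ> \<inter> Pow (nlists n \<int>) \<and> D'' i \<in> \<DD> \<inter> Pow (nlists n {0..<1})"
      using X(3) Y(3) by (auto simp del: Int_iff simp: Z''_def D''_def)
  qed
  moreover have "p + q \<ge> 1" using X(2) by simp
  ultimately show ?thesis unfolding mixed_level_def by blast
qed

text \<open>This reduces a closure property to single sums, provided the operation is compatible
  with \<open>\<union>\<close>. Since \<open>p \<ge> 1\<close>, the base case is one sum and the
  empty union needs no case of its own.\<close>

lemma mixed_level_induct [consumes 1, case_names sum Un]:
  assumes "X \<in> mixed_level \<ZZ> \<DD> n"
    and sum: "\<And>Z D. Z \<in> \<ZZ> \<inter> Pow (nlists n \<int>) \<Longrightarrow> D \<in> \<DD> \<inter> Pow (nlists n {0..<1}) \<Longrightarrow> P (set_sum Z D)"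
    and Un: "\<And>X Y. P X \<Longrightarrow> P Y \<Longrightarrow> P (X \<union> Y)"
  shows "P X"
proof -
  obtain p :: nat and Z D where X: "X = (\<Union>i\<in>{1..p}. set_sum (Z i) (D i))" "p \<ge> 1"
    "\<forall>i\<in>{1..p}. Z i \<in> \<ZZ> \<inter> Pow (nlists n \<int>) \<and> D i \<in> \<DD> \<inter> Pow (nlists n {0..<1})"
    using assms(1) unfolding mixed_level_def by blast
  from X(2,3) have "P (\<Union>i\<in>{1..p}. set_sum (Z i) (D i))"
  proof (induction p rule: nat_induct_at_least)
    case base
    then show ?case using sum by simp
  next
    case (Suc k)
    then have "P ((\<Union>i\<in>{1..k}. set_sum (Z i) (D i)) \<union> set_sum (Z (Suc k)) (D (Suc k)))"
      by (intro Un sum Suc.IH) auto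
    then show ?case by (simp add: atLeastAtMostSuc_conv Un_commute)
  qed
  then show ?thesis using X by simp
qed

lemma mixed_level_subset:
  assumes "X \<in> mixed_level \<ZZ> \<DD> n"
  shows "X \<subseteq> nlists n UNIV"
  using assms
proof (induction rule: mixed_level_induct)
  case (sum Z D)
  then have "length z = n" "length d = n" if "z \<in> Z" "d \<in> D" for z d
    using that length_subset_nlists by blast+
  then show ?case by (auto simp: set_sum_def nlists_def)
qed simp

section \<open>Closure of the levels under the operations\<close>

lemma mixed_level_Int:
  assumes st: "stable_class \<ZZ>" "stable_class \<DD>"
    and "X \<in> mixed_level \<ZZ> \<DD> n" "Y \<in> mixed_level \<ZZ> \<DD> n"
  shows "X \<inter> Y \<in> mixed_level \<ZZ> \<DD> n"
  using assms(3)
proof (induction rule: mixed_level_induct)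
  case (sum Z D)
  \<comment> \<open>With the first argument already a single sum, a second induction reduces the
    other argument to a single sum as well.\<close>
  show ?case using assms(4)
  proof (induction rule: mixed_level_induct)
    case (sum Z' D')
    have "set_sum Z D \<inter> set_sum Z' D' = set_sum (Z \<inter> Z') (D \<inter> D')"
      using sum \<open>Z \<in> _\<close> \<open>D \<in> _\<close> by (intro set_sum_Int[of _ n]) auto
    then show ?case
      using set_sum_in_mixed_level[OF stable_class_boolean(2)[OF st(1) \<open>Z \<in> _\<close> \<open>Z' \<in> _\<close>]
          stable_class_boolean(2)[OF st(2) \<open>D \<in> _\<close> \<open>D' \<in> _\<close>]] by simp
  next
    case (Un X Y)
    then show ?case by (simp add: Int_Un_distrib mixed_level_Un)
  qed
next
  case (Un X Y)
  then show ?case by (simp add: Int_Un_distrib2 mixed_level_Un)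
qed

text \<open>Again by nested induction. A union on the left stays a union, but one on the right
  becomes an intersection of differences, so closure under intersection must come first.\<close>

lemma mixed_level_Diff:
  assumes st: "stable_class \<ZZ>" "stable_class \<DD>"
    and "X \<in> mixed_level \<ZZ> \<DD> n" "Y \<in> mixed_level \<ZZ> \<DD> n"
  shows "X - Y \<in> mixed_level \<ZZ> \<DD> n"
  using assms(3)
proof (induction rule: mixed_level_induct)
  case (sum Z D)
  show ?case using assms(4)
  proof (induction rule: mixed_level_induct)
    case (sum Z' D')
    have "set_sum Z D - set_sum Z' D' = set_sum (Z - Z') D \<union> set_sum Z (D - D')"
      using sum \<open>Z \<in> _\<close> \<open>D \<in> _\<close> by (intro set_sum_Diff[of _ n]) auto
    then show ?case
      using set_sum_in_mixed_level[OF stable_class_boolean(3)[OF st(1) \<open>Z \<in> _\<close> \<open>Z' \<in> _\<close>] \<open>D \<in> _\<close>]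
        set_sum_in_mixed_level[OF \<open>Z \<in> _\<close> stable_class_boolean(3)[OF st(2) \<open>D \<in> _\<close> \<open>D' \<in> _\<close>]]
      by (simp add: mixed_level_Un)
  next
    case (Un X Y)
    then show ?case by (simp add: Diff_Un mixed_level_Int[OF st])
  qed
next
  case (Un X Y)
  then show ?case by (simp add: Un_Diff mixed_level_Un)
qed

lemma mixed_level_product:
  assumes st: "stable_class \<ZZ>" "stable_class \<DD>"
    and "X \<in> mixed_level \<ZZ> \<DD> n" "Y \<in> mixed_level \<ZZ> \<DD> m"
  shows "set_product X Y \<in> mixed_level \<ZZ> \<DD> (n + m)"
  using assms(3)
proof (induction rule: mixed_level_induct)
  case (sum Z D)
  show ?case using assms(4)
  proof (induction rule: mixed_level_induct)
    case (sum Z' D')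
    have "set_product (set_sum Z D) (set_sum Z' D') = set_sum (set_product Z Z') (set_product D D')"
      using \<open>Z \<in> _\<close> \<open>D \<in> _\<close> by (intro set_sum_product) auto
    then show ?case
      using set_sum_in_mixed_level[OF stable_class_product[OF st(1) \<open>Z \<in> _\<close> \<open>Z' \<in> _\<close>]
          stable_class_product[OF st(2) \<open>D \<in> _\<close> \<open>D' \<in> _\<close>]] by simp
  next
    case (Un A B)
    have "set_product (set_sum Z D) (A \<union> B) =
        set_product (set_sum Z D) A \<union> set_product (set_sum Z D) B"
      unfolding set_product_def by blast
    then show ?case using Un by (simp add: mixed_level_Un)
  qed
next
  case (Un A B)
  have "set_product (A \<union> B) Y = set_product A Y \<union> set_product B Y"
    unfolding set_product_def by blast
  then show ?case using Un by (simp add: mixed_level_Un)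
qed

text \<open>An existential quantifier distributes over \<open>\<union>\<close>, so the case of a
  single sum suffices.\<close>

lemma mixed_level_project_out:
  assumes st: "stable_class \<ZZ>" "stable_class \<DD>"
    and "X \<in> mixed_level \<ZZ> \<DD> n" "i < n"
  shows "project_out i X \<in> mixed_level \<ZZ> \<DD> (n - 1)"
  using assms(3)
proof (induction rule: mixed_level_induct)
  case (sum Z D)
  have "project_out i (set_sum Z D) = set_sum (project_out i Z) (project_out i D)"
    using sum by (intro set_sum_project_out) auto
  then show ?case
    using set_sum_in_mixed_level[OF stable_class_project_out[OF st(1) sum(1) \<open>i < n\<close>]
        stable_class_project_out[OF st(2) sum(2) \<open>i < n\<close>]] by simp
next
  case (Un A B)
  have "project_out i (A \<union> B) = project_out i A \<union> project_out i B"
    unfolding project_out_def by blast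
  then show ?case using Un by (simp add: mixed_level_Un)
qed

lemma mixed_level_permute:
  assumes st: "stable_class \<ZZ>" "stable_class \<DD>"
    and "X \<in> mixed_level \<ZZ> \<DD> n" "\<pi> permutes {..<n}"
  shows "permute_list \<pi> ` X \<in> mixed_level \<ZZ> \<DD> n"
  using assms(3)
proof (induction rule: mixed_level_induct)
  case (sum Z D)
  have "permute_list \<pi> ` set_sum Z D = set_sum (permute_list \<pi> ` Z) (permute_list \<pi> ` D)"
    using sum assms(4) by (intro set_sum_permute) auto
  then show ?case
    using set_sum_in_mixed_level[OF stable_class_permute[OF st(1) sum(1) assms(4)]
        stable_class_permute[OF st(2) sum(2) assms(4)]] by simp
next
  case (Un A B)
  then show ?case by (simp add: image_Un mixed_level_Un)
qed

text \<open>The content is the case \<open>X = {}\<close>, where \<open>X\<close> may stem from a level other than \<open>n\<close>.\<close>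

lemma mixed_class_level:
  assumes st: "stable_class \<ZZ>" "stable_class \<DD>"
    and "X \<in> (\<ZZ> \<uplus> \<DD>) \<inter> Pow (nlists n UNIV)"
  shows "X \<in> mixed_level \<ZZ> \<DD> n"
proof -
  obtain m where m: "X \<in> mixed_level \<ZZ> \<DD> m"
    using assms(3) unfolding mixed_class_def by blast
  show ?thesis
  proof (cases "X = {}")
    case True
    \<comment> \<open>Because \<open>p \<ge> 1\<close>, level \<open>m\<close> provides a member of
      each class; hence both classes contain the empty set in every dimension.\<close>
    obtain Z D where "Z \<in> \<ZZ> \<inter> Pow (nlists m \<int>)" "D \<in> \<DD> \<inter> Pow (nlists m {0..<1})"
      using m unfolding mixed_level_def by fastforce
    then have "set_sum {} {} \<in> mixed_level \<ZZ> \<DD> n"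
      by (intro set_sum_in_mixed_level stable_class_empty[OF st(1)] stable_class_empty[OF st(2)])
    then show ?thesis using True by (simp add: set_sum_def)
  next
    case False
    \<comment> \<open>The length of a single point determines the level.\<close>
    then obtain r where "r \<in> X" by blast
    then have "length r = m" "length r = n"
      using assms(3) mixed_level_subset[OF m] length_subset_nlists by blast+
    then show ?thesis using m by simp
  qed
qed

theorem proposition6:
  fixes \<ZZ> \<DD> :: "real list set set"
  assumes "\<ZZ> \<subseteq> (\<Union>n. Pow (nlists n \<int>))"
    and "\<DD> \<subseteq> (\<Union>n. Pow (nlists n {0..<1}))"
    and "stable_class \<ZZ>"
    and "stable_class \<DD>"
  shows "stable_class (\<ZZ> \<uplus> \<DD>)"
proof -
  note st = assms(3,4)
  have level: "X \<in> \<ZZ> \<uplus> \<DD>" if "X \<in> mixed_level \<ZZ> \<DD> n" for X n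
    using that unfolding mixed_class_def by blast
  \<comment> \<open>Each clause below follows one pattern: \<open>in_level\<close> puts the
    arguments on the level of the given dimension, a closure lemma acts there, and
    \<open>level\<close> returns to the class.\<close>
  note in_level = mixed_class_level[OF st]
  show ?thesis
    unfolding stable_class_def
  proof (intro conjI allI ballI impI)
    show "\<ZZ> \<uplus> \<DD> \<subseteq> (\<Union>n. Pow (nlists n UNIV))"
      unfolding mixed_class_def using mixed_level_subset by blast
  next
    fix n R R'
    assume "R \<in> (\<ZZ> \<uplus> \<DD>) \<inter> Pow (nlists n UNIV)" "R' \<in> (\<ZZ> \<uplus> \<DD>) \<inter> Pow (nlists n UNIV)"
    note R = this[THEN in_level]
    show "R \<union> R' \<in> \<ZZ> \<uplus> \<DD>" by (rule level[OF mixed_level_Un[OF R]])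
    show "R \<inter> R' \<in> \<ZZ> \<uplus> \<DD>" by (rule level[OF mixed_level_Int[OF st R]])
    show "R - R' \<in> \<ZZ> \<uplus> \<DD>" by (rule level[OF mixed_level_Diff[OF st R]])
  next
    fix n m R R'
    assume "R \<in> (\<ZZ> \<uplus> \<DD>) \<inter> Pow (nlists n UNIV)" "R' \<in> (\<ZZ> \<uplus> \<DD>) \<inter> Pow (nlists m UNIV)"
    note R = this[THEN in_level]
    show "set_product R R' \<in> \<ZZ> \<uplus> \<DD>" by (rule level[OF mixed_level_product[OF st R]])
  next
    fix n R i
    assume "R \<in> (\<ZZ> \<uplus> \<DD>) \<inter> Pow (nlists n UNIV)" and i: "i < n"
    note R = this(1)[THEN in_level]
    show "project_out i R \<in> \<ZZ> \<uplus> \<DD>" by (rule level[OF mixed_level_project_out[OF st R i]])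
  next
    fix n R \<pi>
    assume "R \<in> (\<ZZ> \<uplus> \<DD>) \<inter> Pow (nlists n UNIV)" and \<pi>: "\<pi> permutes {..<n}"
    note R = this(1)[THEN in_level]
    show "permute_list \<pi> ` R \<in> \<ZZ> \<uplus> \<DD>" by (rule level[OF mixed_level_permute[OF st R \<pi>]])
  qed
qed

end
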